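(* Let $E(\rho,\theta)$ be the energy function of the lossy network with constant ratio $\kappa$, $$E(\rho,\theta)=-\sum_{i\in\mathrm{pq}}\big((P_i+\kappa Q_i)\theta_i+(\kappa P_i-Q_i)\rho_i\big)+\sum_{(i,j)\in\mathcal{E}}B_{ij}(\kappa^2+1)\frac{\exp(2\rho_i)+\exp(2\rho_j)}{2}-\sum_{(i,j)\in\mathcal{E}}B_{ij}(\kappa^2+1)\exp(\rho_i+\rho_j)\cos(\theta_i-\theta_j).$$ Then $E$ is convex in $(\rho,\theta)$ over the domain of all $(\rho,\theta)$ satisfying $$|\theta_i-\theta_j|\le\frac{\pi}{2}\qquad\forall(i,j)\in\mathcal{E}$$ and $$\sum_{i\in\mathrm{pq}}\Big[\,2B_i-\sum_{j\in\{s\}}B_{ij}\frac{\exp(\rho_{ji})}{\cos(\theta_{ij})}\Big]_{ii}^{\mathrm{pq}}-\sum_{(i,j)\in\mathcal{E},\;i,j\in\mathrm{pq}}\frac{B_{ij}}{\cos(\theta_{ij})}\left[\begin{pmatrix}\exp(\rho_{ji})&1\\1&\exp(\rho_{ij})\end{pmatrix}\right]_{ij}^{\mathrm{pq}}\succeq0 .$$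
   Context: Network: $(\mathcal{V},\mathcal{E})$ is a finite simple graph; each edge is given one arbitrary orientation, so that for an edge between $i$ and $j$ exactly one of $(i,j),(j,i)$ is in $\mathcal{E}$; write $i\sim j$ if there is an edge between $i$ and $j$. Line $(i,j)$ has admittance $G_{ij}-\mathbf{j}B_{ij}$ with $\mathbf{j}=\sqrt{-1}$, $B_{ij}=B_{ji}>0$, and $G_{ij}/B_{ij}=\kappa$ for the same real constant $\kappa$ for all lines; set $B_{ij}=0$ if $i\not\sim j$. All buses except the slack bus $s$ are $(P,Q)$ buses: $\mathcal{V}=\mathrm{pq}\cup\{s\}$ (disjoint union). $B_i=\sum_{j\sim i}B_{ij}$. $P_i,Q_i$ ($i\in\mathrm{pq}$) are fixed real constants. Variables: $\rho=(\rho_i)_{i\in\mathrm{pq}}$ and $\theta=(\theta_i)_{i\in\mathrm{pq}}$ are real vectors, with $\rho_s=\theta_s=0$ fixed. Write $\rho_{ij}=\rho_i-\rho_j$, $\theta_{ij}=\theta_i-\theta_j$. Matrix notation: for an index set $T$, $[a]_{ii}^{T}$ is the $|T|\times|T|$ matrix (rows and columns indexed by $T$) with $(i,i)$ entry $a$ and all other entries $0$; $\left[\begin{pmatrix}a&b\\c&d\end{pmatrix}\right]_{ij}^{T}$ is the $|T|\times|T|$ matrix $M$ with $M_{ii}=a$, $M_{ij}=b$, $M_{ji}=c$, $M_{jj}=d$ and all other entries $0$. $M\succeq0$ means positive semidefinite. The matrix inequality is understood to require $\cos(\theta_{ij})\neq0$ for every edge whose cosine appears in a denominator. *)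

theory Defs
  imports "HOL-Analysis.Analysis"
begin

text \<open>
  The buses are the elements of the finite type \<open>'v\<close>. A pair in \<open>E\<close> is a line with its chosen
  orientation. \<open>\<kappa>\<close> is the common ratio; line \<open>(i,j)\<close> has admittance \<open>G i j - \<i> * B i j\<close>.
\<close>

definition adj :: "('v \<times> 'v) set \<Rightarrow> 'v \<Rightarrow> 'v \<Rightarrow> bool" where
  "adj E i j \<longleftrightarrow> (i, j) \<in> E \<or> (j, i) \<in> E"

locale const_ratio_network =
  fixes E :: "('v::finite \<times> 'v) set"
    and G B :: "'v \<Rightarrow> 'v \<Rightarrow> real"
    and \<kappa> :: real
  assumes no_loops: "(i, i) \<notin> E"
    and one_orientation: "(i, j) \<in> E \<Longrightarrow> (j, i) \<notin> E"
    and B_sym: "B i j = B j i"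
    and B_pos: "adj E i j \<Longrightarrow> B i j > 0"
    and B_zero: "\<not> adj E i j \<Longrightarrow> B i j = 0"
    and ratio: "adj E i j \<Longrightarrow> G i j / B i j = \<kappa>"

definition pq :: "'v \<Rightarrow> 'v set" where
  "pq s = UNIV - {s}"

definition B_sum :: "('v \<times> 'v) set \<Rightarrow> ('v \<Rightarrow> 'v \<Rightarrow> real) \<Rightarrow> 'v \<Rightarrow> real" where
  "B_sum E B i = (\<Sum>j | adj E j i. B i j)"

definition energy ::
  "'v::finite \<Rightarrow> ('v \<times> 'v) set \<Rightarrow> ('v \<Rightarrow> 'v \<Rightarrow> real) \<Rightarrow> real \<Rightarrow> ('v \<Rightarrow> real) \<Rightarrow> ('v \<Rightarrow> real)
    \<Rightarrow> (real^'v) \<times> (real^'v) \<Rightarrow> real"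
where
  "energy s E B \<kappa> P Q = (\<lambda>(\<rho>, \<theta>).
     - (\<Sum>i\<in>pq s. (P i + \<kappa> * Q i) * \<theta>$i + (\<kappa> * P i - Q i) * \<rho>$i)
     + (\<Sum>(i, j)\<in>E. B i j * (\<kappa>\<^sup>2 + 1) * ((exp (2 * \<rho>$i) + exp (2 * \<rho>$j)) / 2))
     - (\<Sum>(i, j)\<in>E. B i j * (\<kappa>\<^sup>2 + 1) * exp (\<rho>$i + \<rho>$j) * cos (\<theta>$i - \<theta>$j)))"

text \<open>
  Matrices indexed by a set \<open>T\<close> of buses are represented as matrices over \<open>'v\<close> of which only the
  entries in \<open>T \<times> T\<close> are used. The two notations \<open>[a]\<^sub>i\<^sub>i\<close> and \<open>[(a b; c d)]\<^sub>i\<^sub>j\<close>: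
\<close>

definition diag_entry :: "'v::finite \<Rightarrow> real \<Rightarrow> real^'v^'v" where
  "diag_entry i a = (\<chi> k l. if k = i \<and> l = i then a else 0)"

definition block_entry :: "'v::finite \<Rightarrow> 'v \<Rightarrow> real \<Rightarrow> real \<Rightarrow> real \<Rightarrow> real \<Rightarrow> real^'v^'v" where
  "block_entry i j a b c d = (\<chi> k l.
     if k = i \<and> l = i then a else
     if k = i \<and> l = j then b else
     if k = j \<and> l = i then c else
     if k = j \<and> l = j then d else 0)"

definition psd_on :: "'v::finite set \<Rightarrow> real^'v^'v \<Rightarrow> bool" where
  "psd_on T M \<longleftrightarrow> (\<forall>i\<in>T. \<forall>j\<in>T. M$i$j = M$j$i) \<and>
     (\<forall>x :: 'v \<Rightarrow> real. 0 \<le> (\<Sum>i\<in>T. \<Sum>j\<in>T. x i * M$i$j * x j))"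

definition conv_matrix ::
  "'v::finite \<Rightarrow> ('v \<times> 'v) set \<Rightarrow> ('v \<Rightarrow> 'v \<Rightarrow> real) \<Rightarrow> real^'v \<Rightarrow> real^'v \<Rightarrow> real^'v^'v"
where
  "conv_matrix s E B \<rho> \<theta> =
     (\<Sum>i\<in>pq s. diag_entry i
        (2 * B_sum E B i - (\<Sum>j\<in>{s}. B i j * (exp (\<rho>$j - \<rho>$i) / cos (\<theta>$i - \<theta>$j)))))
   - (\<Sum>(i, j) | (i, j) \<in> E \<and> i \<in> pq s \<and> j \<in> pq s.
        (B i j / cos (\<theta>$i - \<theta>$j)) *\<^sub>R
          block_entry i j (exp (\<rho>$j - \<rho>$i)) 1 1 (exp (\<rho>$i - \<rho>$j)))"

text \<open>
  The variables \<open>(\<rho>\<^sub>i)\<close>, \<open>(\<theta>\<^sub>i)\<close>, \<open>i \<in> pq s\<close>, are represented as vectors over all buses whose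
  slack coordinate is \<open>0\<close>. Every line has an end in \<open>pq s\<close>, so its cosine occurs in a denominator
  of \<open>conv_matrix\<close> and has to be nonzero (Isabelle's \<open>x / 0 = 0\<close> would admit those points).
\<close>

definition conv_domain ::
  "'v::finite \<Rightarrow> ('v \<times> 'v) set \<Rightarrow> ('v \<Rightarrow> 'v \<Rightarrow> real) \<Rightarrow> ((real^'v) \<times> (real^'v)) set"
where
  "conv_domain s E B = {(\<rho>, \<theta>).
     \<rho>$s = 0 \<and> \<theta>$s = 0 \<and>
     (\<forall>(i, j)\<in>E. \<bar>\<theta>$i - \<theta>$j\<bar> \<le> pi / 2) \<and>
     (\<forall>(i, j)\<in>E. cos (\<theta>$i - \<theta>$j) \<noteq> 0) \<and>
     psd_on (pq s) (conv_matrix s E B \<rho> \<theta>)}"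

end

theory Submission
  imports Defs
begin

text \<open>
  Evaluated at a vector \<open>x\<close> with \<open>x s = 0\<close>, the matrix of the domain splits into one quadratic form
  per line: its value is the sum over the lines of \<open>B i j\<close> times
  \[ 2 x_i^2 + 2 x_j^2 - \frac{(e^{-u/2} x_i + e^{u/2} x_j)^2}{\cos t},
     \qquad u = \rho_i - \rho_j,\ t = \theta_i - \theta_j \]
  (\<open>quad_form_conv_matrix\<close>). Two facts about this edge form, called \<open>edge_slack\<close> below, give the
  theorem.

  First, for fixed \<open>x\<close> it is concave in \<open>(u, t)\<close> (\<open>edge_slack_concave\<close>): the cosine is concave and
  positive, the absolute value of a combination of \<open>exp\<close> and \<open>exp \<circ> uminus\<close> is convex, and \<open>g\<^sup>2 / h\<close> is
  convex whenever \<open>g \<ge> 0\<close> is convex and \<open>h > 0\<close> is concave. Since \<open>u\<close> and \<open>t\<close> are linear in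
  \<open>(\<rho>, \<theta>)\<close>, the domain is cut out by linear equations, convex angle bounds and superlevel sets of
  concave functions, one for each \<open>x\<close>; hence it is convex (\<open>convex_conv_domain\<close>).

  Second, it bounds the Hessian of the energy from below. Along a direction \<open>(a, b)\<close> the second
  derivative of one line term is a quadratic polynomial in \<open>b\<^sub>i - b\<^sub>j\<close> with leading coefficient
  proportional to \<open>cos t > 0\<close>; completing the square eliminates the angles and leaves
  \<open>B i j * (\<kappa>\<^sup>2 + 1)\<close> times the edge form at \<open>x\<^sub>i = exp \<rho>\<^sub>i * a\<^sub>i\<close> (\<open>edge_hessian_ge_edge_slack\<close>). The slack coordinate of
  \<open>\<rho>\<close> being fixed, \<open>x s = 0\<close>, so the matrix condition makes the second derivative nonnegative
  along every segment of the domain.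
\<close>

section \<open>Concavity of the edge form\<close>

definition edge_slack :: "real \<Rightarrow> real \<Rightarrow> real \<Rightarrow> real \<Rightarrow> real" where
  "edge_slack u t x y = 2 * x\<^sup>2 + 2 * y\<^sup>2 - (exp (- u / 2) * x + exp (u / 2) * y)\<^sup>2 / cos t"

lemma edge_slack_expand:
  "edge_slack u t x y =
     2 * x\<^sup>2 + 2 * y\<^sup>2 - (exp (- u) * x\<^sup>2 + 2 * x * y + exp u * y\<^sup>2) / cos t"
proof -
  have "(exp (- u / 2) * x + exp (u / 2) * y)\<^sup>2
      = (exp (- u / 2))\<^sup>2 * x\<^sup>2 + 2 * (exp (- u / 2) * exp (u / 2)) * x * y + (exp (u / 2))\<^sup>2 * y\<^sup>2"
    by (simp add: power2_eq_square algebra_simps)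
  then show ?thesis
    by (simp add: edge_slack_def flip: exp_add exp_double)
qed

lemma sinh_mult_le:
  fixes \<alpha> L :: real
  assumes "0 \<le> \<alpha>" "\<alpha> \<le> 1" "0 \<le> L"
  shows "sinh (\<alpha> * L) \<le> \<alpha> * sinh L"
proof -
  have "convex_on {0..} (sinh :: real \<Rightarrow> real)"
    by (rule f''_ge0_imp_convex[where f' = cosh and f'' = sinh])
       (auto intro!: derivative_eq_intros)
  from convex_onD[OF this, of \<alpha> 0 L] assms show ?thesis by simp
qed

text \<open>
  The function \<open>h\<close> inside the absolute value solves \<open>h'' = h\<close>, so it is interpolated exactly by
  \[ \sinh (b - a)\, h(m) = \sinh (b - m)\, h(a) + \sinh (m - a)\, h(b). \]
  For \<open>a \<le> m \<le> b\<close> the weights are nonnegative and, by convexity of \<open>sinh\<close> on the nonnegative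
  half-line, at most the linear ones. This treats all signs of \<open>x\<close> and \<open>y\<close> at once, although \<open>h\<close>
  itself need not be convex.
\<close>
lemma abs_exp_comb_convex:
  fixes x y :: real
  shows "convex_on UNIV (\<lambda>u. \<bar>x * exp u + y * exp (- u)\<bar>)"
proof -
  define h where "h u = x * exp u + y * exp (- u)" for u
  have ordered: "\<bar>h ((1 - \<alpha>) * a + \<alpha> * b)\<bar> \<le> (1 - \<alpha>) * \<bar>h a\<bar> + \<alpha> * \<bar>h b\<bar>"
    if \<alpha>: "0 < \<alpha>" "\<alpha> < 1" and "a < b" for \<alpha> a b
  proof -
    define m where "m = (1 - \<alpha>) * a + \<alpha> * b"
    define p where "p = sinh (b - m)"
    define q where "q = sinh (m - a)"
    have pos: "sinh (b - a) > 0" using \<open>a < b\<close> by simp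
    have bm: "b - m = (1 - \<alpha>) * (b - a)" and ma: "m - a = \<alpha> * (b - a)"
      by (simp_all add: m_def algebra_simps)
    have p: "0 \<le> p" "p \<le> (1 - \<alpha>) * sinh (b - a)"
      and q: "0 \<le> q" "q \<le> \<alpha> * sinh (b - a)"
      using sinh_mult_le[of "1 - \<alpha>" "b - a"] sinh_mult_le[of \<alpha> "b - a"] \<alpha> \<open>a < b\<close>
      by (simp_all add: p_def q_def bm ma)
    have "sinh (b - a) * h m = p * h a + q * h b"
      by (simp add: p_def q_def h_def sinh_field_def field_simps exp_add exp_diff exp_minus)
    then have "sinh (b - a) * \<bar>h m\<bar> = \<bar>p * h a + q * h b\<bar>"
      using pos by (metis abs_mult abs_of_pos)
    also have "\<dots> \<le> p * \<bar>h a\<bar> + q * \<bar>h b\<bar>"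
      using p q by (metis abs_mult abs_of_nonneg abs_triangle_ineq)
    also have "\<dots> \<le> (1 - \<alpha>) * sinh (b - a) * \<bar>h a\<bar> + \<alpha> * sinh (b - a) * \<bar>h b\<bar>"
      using p q by (intro add_mono mult_right_mono) auto
    also have "\<dots> = sinh (b - a) * ((1 - \<alpha>) * \<bar>h a\<bar> + \<alpha> * \<bar>h b\<bar>)"
      by (simp add: algebra_simps)
    finally show ?thesis using pos by (simp add: m_def)
  qed
  show ?thesis
    unfolding h_def[symmetric]
    by (rule convex_on_linorderI) (use ordered in auto)
qed

lemma cos_concave: "concave_on {- (pi / 2)..pi / 2} (cos :: real \<Rightarrow> real)"
  unfolding concave_on_def
  by (rule f''_ge0_imp_convex[where f' = sin and f'' = cos])
     (auto intro!: derivative_eq_intros cos_ge_zero)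

text \<open>
  The function \<open>(c, d) \<mapsto> c\<^sup>2 / d\<close> is the supremum over \<open>k\<close> of the affine functions
  \<open>2 * k * c - k\<^sup>2 * d\<close>. For \<open>k \<ge> 0\<close> these increase in \<open>c\<close> and decrease in \<open>d\<close>, which is why
  inequalities for \<open>g\<close> and \<open>h\<close> suffice.
\<close>
lemma square_over_linear_mono:
  fixes g h g1 h1 g2 h2 \<alpha> \<beta> :: real
  assumes "0 \<le> \<alpha>" "0 \<le> \<beta>" "0 < h1" "0 < h2" "0 < h"
    and "\<bar>g\<bar> \<le> \<alpha> * \<bar>g1\<bar> + \<beta> * \<bar>g2\<bar>" and "\<alpha> * h1 + \<beta> * h2 \<le> h"
  shows "g\<^sup>2 / h \<le> \<alpha> * (g1\<^sup>2 / h1) + \<beta> * (g2\<^sup>2 / h2)"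
proof -
  \<comment> \<open>the slope at which the affine minorant touches at \<open>(g, h)\<close>\<close>
  define k where "k = \<bar>g\<bar> / h"
  have k: "0 \<le> k" using assms by (simp add: k_def)
  have tangent: "2 * k * \<bar>c\<bar> - k\<^sup>2 * d \<le> c\<^sup>2 / d" if "d > 0" for c d
  proof -
    have "0 \<le> (\<bar>c\<bar> - k * d)\<^sup>2 / d" using that by simp
    also have "\<dots> = c\<^sup>2 / d - 2 * k * \<bar>c\<bar> + k\<^sup>2 * d"
      using that by (simp add: power2_diff power_mult_distrib field_simps power2_eq_square)
    finally show ?thesis by simp
  qed
  have "g\<^sup>2 / h = 2 * k * \<bar>g\<bar> - k\<^sup>2 * h"
    using assms by (simp add: k_def power2_eq_square)
  also have "\<dots> \<le> 2 * k * (\<alpha> * \<bar>g1\<bar> + \<beta> * \<bar>g2\<bar>) - k\<^sup>2 * (\<alpha> * h1 + \<beta> * h2)"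
    using assms k by (intro diff_mono mult_left_mono) auto
  also have "\<dots> = \<alpha> * (2 * k * \<bar>g1\<bar> - k\<^sup>2 * h1) + \<beta> * (2 * k * \<bar>g2\<bar> - k\<^sup>2 * h2)"
    by (simp add: algebra_simps)
  also have "\<dots> \<le> \<alpha> * (g1\<^sup>2 / h1) + \<beta> * (g2\<^sup>2 / h2)"
    using assms by (intro add_mono mult_left_mono tangent) auto
  finally show ?thesis .
qed

lemma edge_slack_concave:
  assumes "0 \<le> \<alpha>" "0 \<le> \<beta>" "\<alpha> + \<beta> = 1" "\<bar>t1\<bar> < pi / 2" "\<bar>t2\<bar> < pi / 2"
  shows "\<alpha> * edge_slack u1 t1 x y + \<beta> * edge_slack u2 t2 x y
       \<le> edge_slack (\<alpha> * u1 + \<beta> * u2) (\<alpha> * t1 + \<beta> * t2) x y"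
proof -
  define h where "h v = y * exp v + x * exp (- v)" for v
  have es: "edge_slack u t x y = 2 * x\<^sup>2 + 2 * y\<^sup>2 - (h (u / 2))\<^sup>2 / cos t" for u t
    by (simp add: edge_slack_def h_def algebra_simps)
  have \<alpha>: "\<alpha> = 1 - \<beta>" using assms by simp
  have cos_le: "\<alpha> * cos t1 + \<beta> * cos t2 \<le> cos (\<alpha> * t1 + \<beta> * t2)"
    using concave_onD[OF cos_concave, of \<beta> t1 t2] assms(1-3)
      assms(4,5)[THEN abs_less_iff[THEN iffD1]]
    by (auto simp: \<alpha>)
  have c: "0 < cos t1" "0 < cos t2"
    using assms by (auto intro!: cos_gt_zero_pi)
  have "0 < \<alpha> * cos t1 + \<beta> * cos t2"
    using assms c by (cases "\<alpha> = 0") (auto intro: add_pos_nonneg)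
  with cos_le have c3: "0 < cos (\<alpha> * t1 + \<beta> * t2)" by linarith
  have h: "\<bar>h ((\<alpha> * u1 + \<beta> * u2) / 2)\<bar> \<le> \<alpha> * \<bar>h (u1 / 2)\<bar> + \<beta> * \<bar>h (u2 / 2)\<bar>"
    using convex_onD[OF abs_exp_comb_convex[of y x], of \<beta> "u1 / 2" "u2 / 2"] assms
    by (auto simp: \<alpha> h_def add_divide_distrib)
  have "(h ((\<alpha> * u1 + \<beta> * u2) / 2))\<^sup>2 / cos (\<alpha> * t1 + \<beta> * t2)
      \<le> \<alpha> * ((h (u1 / 2))\<^sup>2 / cos t1) + \<beta> * ((h (u2 / 2))\<^sup>2 / cos t2)"
    by (rule square_over_linear_mono) (use assms c c3 h cos_le in auto)
  moreover have "\<alpha> * (2 * x\<^sup>2 + 2 * y\<^sup>2) + \<beta> * (2 * x\<^sup>2 + 2 * y\<^sup>2) = 2 * x\<^sup>2 + 2 * y\<^sup>2"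
    using assms by (metis distrib_right mult_1)
  ultimately show ?thesis
    unfolding es right_diff_distrib by linarith
qed

section \<open>The domain\<close>

text \<open>
  Each line is seen from both of its ends. A single orientation per line keeps the edge set
  disjoint from its converse, so no line is counted too often.
\<close>
lemma sum_adj_eq_sum_edges:
  fixes f :: "'v::finite \<Rightarrow> 'v \<Rightarrow> real"
  assumes "\<And>i j. (i, j) \<in> E \<Longrightarrow> (j, i) \<notin> E"
  shows "(\<Sum>i\<in>UNIV. \<Sum>j | adj E j i. f i j) = (\<Sum>(i, j)\<in>E. f i j + f j i)"
proof -
  have "(\<Sum>i\<in>UNIV. \<Sum>j | adj E j i. f i j) = (\<Sum>(i, j)\<in>E \<union> E\<inverse>. f i j)"
    by (subst sum.Sigma) (auto simp: adj_def intro!: sum.cong)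
  also have "\<dots> = (\<Sum>(i, j)\<in>E. f i j) + (\<Sum>(i, j)\<in>E\<inverse>. f i j)"
    using assms by (intro sum.union_disjoint) auto
  also have "(\<Sum>(i, j)\<in>E\<inverse>. f i j) = (\<Sum>(i, j)\<in>E. f j i)"
    by (rule sum.reindex_bij_witness[of _ prod.swap prod.swap]) auto
  finally show ?thesis
    by (simp add: sum.distrib split_def)
qed

lemma quad_form_diag_entry:
  "(\<Sum>k\<in>UNIV. \<Sum>l\<in>UNIV. x k * diag_entry i a $ k $ l * x l) = a * (x i)\<^sup>2"
proof -
  have "(\<Sum>k\<in>UNIV. \<Sum>l\<in>UNIV. x k * diag_entry i a $ k $ l * x l)
      = (\<Sum>k\<in>UNIV. \<Sum>l\<in>UNIV. if l = i then if k = i then a * x i * x i else 0 else 0)"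
    by (intro sum.cong) (auto simp: diag_entry_def)
  then show ?thesis by (simp add: power2_eq_square)
qed

lemma quad_form_block_entry:
  assumes "i \<noteq> j"
  shows "(\<Sum>k\<in>UNIV. \<Sum>l\<in>UNIV. x k * block_entry i j a b c d $ k $ l * x l)
       = a * (x i)\<^sup>2 + (b + c) * x i * x j + d * (x j)\<^sup>2"
proof -
  have "(\<Sum>k\<in>UNIV. \<Sum>l\<in>UNIV. x k * block_entry i j a b c d $ k $ l * x l)
      = (\<Sum>k\<in>UNIV. \<Sum>l\<in>UNIV.
          (if l = i then (if k = i then a * x i * x i else 0) + (if k = j then c * x j * x i else 0) else 0)
        + (if l = j then (if k = i then b * x i * x j else 0) + (if k = j then d * x j * x j else 0) else 0))"
    using assms by (intro sum.cong) (auto simp: block_entry_def)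
  also have "\<dots> = a * (x i)\<^sup>2 + (b + c) * x i * x j + d * (x j)\<^sup>2"
    by (simp add: sum.distrib power2_eq_square algebra_simps)
  finally show ?thesis .
qed

context const_ratio_network
begin

text \<open>
  The terms \<open>2 * B_sum E B i\<close> are distributed to the lines at \<open>i\<close>. For a line with an end at the
  slack bus, \<open>x s = 0\<close> leaves of the subtracted square only the diagonal term that the matrix
  subtracts for that line; either orientation gives the same term, because the cosine is even.
\<close>
lemma quad_form_conv_matrix:
  assumes "x s = 0"
  shows "(\<Sum>k\<in>UNIV. \<Sum>l\<in>UNIV. x k * conv_matrix s E B \<rho> \<theta> $ k $ l * x l)
       = (\<Sum>(i, j)\<in>E. B i j * edge_slack (\<rho>$i - \<rho>$j) (\<theta>$i - \<theta>$j) (x i) (x j))"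
proof -
  define q :: "real^'v^'v \<Rightarrow> real" where "q M = (\<Sum>k\<in>UNIV. \<Sum>l\<in>UNIV. x k * M $ k $ l * x l)" for M
  \<comment> \<open>linearity in the matrix lets the form be read off one matrix summand at a time\<close>
  interpret q: linear q
    by unfold_locales (auto simp: q_def algebra_simps sum.distrib sum_distrib_left)
  define e where "e i j = exp (\<rho>$j - \<rho>$i) / cos (\<theta>$i - \<theta>$j)" for i j
  define I where "I = {(i, j). (i, j) \<in> E \<and> i \<in> pq s \<and> j \<in> pq s}"
  have diag: "(\<Sum>i\<in>pq s. (2 * B_sum E B i - B i s * e i s) * (x i)\<^sup>2)
      = (\<Sum>(i, j)\<in>E. B i j * (2 * (x i)\<^sup>2 + 2 * (x j)\<^sup>2)
          - B i j * ((if j = s then e i s * (x i)\<^sup>2 else 0) + (if i = s then e j s * (x j)\<^sup>2 else 0)))"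
    (is "_ = ?R")
  proof -
    have "(\<Sum>i\<in>pq s. (2 * B_sum E B i - B i s * e i s) * (x i)\<^sup>2)
        = (\<Sum>i\<in>UNIV. (2 * B_sum E B i - B i s * e i s) * (x i)\<^sup>2)"
      using assms by (intro sum.mono_neutral_left) (auto simp: pq_def)
    also have "\<dots> = (\<Sum>i\<in>UNIV. \<Sum>j | adj E j i.
        B i j * (2 * (x i)\<^sup>2 - (if j = s then e i s * (x i)\<^sup>2 else 0)))"
    proof (rule sum.cong)
      fix i
      have "(\<Sum>j | adj E j i. B i j * (if j = s then e i s * (x i)\<^sup>2 else 0))
          = (\<Sum>j\<in>UNIV. B i j * (if j = s then e i s * (x i)\<^sup>2 else 0))"
        using B_zero by (intro sum.mono_neutral_left) (auto simp: adj_def)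
      also have "\<dots> = (\<Sum>j\<in>UNIV. if j = s then B i s * e i s * (x i)\<^sup>2 else 0)"
        by (intro sum.cong) auto
      finally show "(2 * B_sum E B i - B i s * e i s) * (x i)\<^sup>2
          = (\<Sum>j | adj E j i. B i j * (2 * (x i)\<^sup>2 - (if j = s then e i s * (x i)\<^sup>2 else 0)))"
        by (simp add: B_sum_def right_diff_distrib left_diff_distrib sum_subtractf
              sum_distrib_right sum_distrib_left mult.assoc mult.left_commute)
    qed simp
    also have "\<dots> = ?R"
      by (subst sum_adj_eq_sum_edges)
         (use one_orientation in \<open>auto intro!: sum.cong simp: B_sym algebra_simps\<close>)
    finally show ?thesis .
  qed
  have block: "(\<Sum>(i, j)\<in>I. B i j / cos (\<theta>$i - \<theta>$j) * q (block_entry i j (exp (\<rho>$j - \<rho>$i)) 1 1 (exp (\<rho>$i - \<rho>$j))))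
      = (\<Sum>(i, j)\<in>E. if i \<noteq> s \<and> j \<noteq> s then B i j / cos (\<theta>$i - \<theta>$j) *
          (exp (\<rho>$j - \<rho>$i) * (x i)\<^sup>2 + 2 * x i * x j + exp (\<rho>$i - \<rho>$j) * (x j)\<^sup>2) else 0)"
  proof (rule sum.mono_neutral_cong_left)
    show "\<forall>p\<in>E - I. (case p of (i, j) \<Rightarrow> if i \<noteq> s \<and> j \<noteq> s then B i j / cos (\<theta>$i - \<theta>$j) *
          (exp (\<rho>$j - \<rho>$i) * (x i)\<^sup>2 + 2 * x i * x j + exp (\<rho>$i - \<rho>$j) * (x j)\<^sup>2) else 0) = 0"
      by (auto simp: I_def pq_def)
    fix p assume "p \<in> I"
    then obtain i j where p: "p = (i, j)" "(i, j) \<in> E" "i \<noteq> s" "j \<noteq> s"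
      by (auto simp: I_def pq_def)
    then have "i \<noteq> j" using no_loops by auto
    with p show "(case p of (i, j) \<Rightarrow> B i j / cos (\<theta>$i - \<theta>$j) * q (block_entry i j (exp (\<rho>$j - \<rho>$i)) 1 1 (exp (\<rho>$i - \<rho>$j))))
      = (case p of (i, j) \<Rightarrow> if i \<noteq> s \<and> j \<noteq> s then B i j / cos (\<theta>$i - \<theta>$j) *
          (exp (\<rho>$j - \<rho>$i) * (x i)\<^sup>2 + 2 * x i * x j + exp (\<rho>$i - \<rho>$j) * (x j)\<^sup>2) else 0)"
      by (simp add: q_def quad_form_block_entry)
  qed (auto simp: I_def)
  have "q (conv_matrix s E B \<rho> \<theta>) =
      (\<Sum>i\<in>pq s. (2 * B_sum E B i - B i s * e i s) * (x i)\<^sup>2)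
    - (\<Sum>(i, j)\<in>I. B i j / cos (\<theta>$i - \<theta>$j) * q (block_entry i j (exp (\<rho>$j - \<rho>$i)) 1 1 (exp (\<rho>$i - \<rho>$j))))"
    by (simp add: conv_matrix_def q.diff q.sum q.scale split_def I_def e_def)
       (simp add: q_def quad_form_diag_entry)
  also have "\<dots> = (\<Sum>(i, j)\<in>E. B i j * edge_slack (\<rho>$i - \<rho>$j) (\<theta>$i - \<theta>$j) (x i) (x j))"
    unfolding diag block sum_subtractf[symmetric]
  proof (rule sum.cong, simp, clarify)
    fix i j assume "(i, j) \<in> E"
    then have "i \<noteq> j" using no_loops by auto
    moreover have "cos (\<theta>$j - \<theta>$i) = cos (\<theta>$i - \<theta>$j)"
      by (metis cos_minus minus_diff_eq)
    ultimately show "B i j * (2 * (x i)\<^sup>2 + 2 * (x j)\<^sup>2)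
          - B i j * ((if j = s then e i s * (x i)\<^sup>2 else 0) + (if i = s then e j s * (x j)\<^sup>2 else 0))
          - (if i \<noteq> s \<and> j \<noteq> s then B i j / cos (\<theta>$i - \<theta>$j) *
          (exp (\<rho>$j - \<rho>$i) * (x i)\<^sup>2 + 2 * x i * x j + exp (\<rho>$i - \<rho>$j) * (x j)\<^sup>2) else 0)
        = B i j * edge_slack (\<rho>$i - \<rho>$j) (\<theta>$i - \<theta>$j) (x i) (x j)"
      using assms by (auto simp: edge_slack_expand e_def right_diff_distrib)
  qed
  finally show ?thesis by (simp add: q_def)
qed

lemma conv_matrix_symmetric: "conv_matrix s E B \<rho> \<theta> $ k $ l = conv_matrix s E B \<rho> \<theta> $ l $ k"
proof -
  have entry: "conv_matrix s E B \<rho> \<theta> $ k $ l =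
      (\<Sum>i\<in>pq s. diag_entry i
          (2 * B_sum E B i - B i s * (exp (\<rho>$s - \<rho>$i) / cos (\<theta>$i - \<theta>$s))) $ k $ l)
    - (\<Sum>(i, j) | (i, j) \<in> E \<and> i \<in> pq s \<and> j \<in> pq s.
          B i j / cos (\<theta>$i - \<theta>$j) *
            block_entry i j (exp (\<rho>$j - \<rho>$i)) 1 1 (exp (\<rho>$i - \<rho>$j)) $ k $ l)" for k l
    by (simp add: conv_matrix_def split_def)
  have diag: "diag_entry i a $ k $ l = diag_entry i a $ l $ k" for i :: 'v and a
    by (simp add: diag_entry_def)
  have block: "block_entry i j a 1 1 d $ k $ l = block_entry i j a 1 1 d $ l $ k"
    if "i \<noteq> j" for i j :: 'v and a d
    using that
    by (cases "k = i"; cases "k = j"; cases "l = i"; cases "l = j") (simp_all add: block_entry_def)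
  show ?thesis
    unfolding entry[of k l] entry[of l k]
  proof (intro arg_cong2[where f = "(-)"] sum.cong refl diag, clarify)
    fix i j assume "(i, j) \<in> E"
    then have "i \<noteq> j" using no_loops by auto
    show "B i j / cos (\<theta>$i - \<theta>$j) *
          block_entry i j (exp (\<rho>$j - \<rho>$i)) 1 1 (exp (\<rho>$i - \<rho>$j)) $ k $ l
        = B i j / cos (\<theta>$i - \<theta>$j) *
          block_entry i j (exp (\<rho>$j - \<rho>$i)) 1 1 (exp (\<rho>$i - \<rho>$j)) $ l $ k"
      by (simp only: block[OF \<open>i \<noteq> j\<close>])
  qed
qed

lemma psd_on_conv_matrix_iff:
  "psd_on (pq s) (conv_matrix s E B \<rho> \<theta>) \<longleftrightarrow>
     (\<forall>x. x s = 0 \<longrightarrow>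
        0 \<le> (\<Sum>(i, j)\<in>E. B i j * edge_slack (\<rho>$i - \<rho>$j) (\<theta>$i - \<theta>$j) (x i) (x j)))"
  (is "_ \<longleftrightarrow> ?rhs")
proof -
  let ?M = "conv_matrix s E B \<rho> \<theta>"
  let ?q = "\<lambda>A x. \<Sum>k\<in>A. \<Sum>l\<in>A. x k * ?M $ k $ l * x l"
  \<comment> \<open>a vector on the buses other than \<open>s\<close> is extended by \<open>0\<close> at \<open>s\<close>\<close>
  have extend: "?q (pq s) x = ?q UNIV (x(s := 0))" for x
  proof -
    have "?q UNIV (x(s := 0)) = (\<Sum>k\<in>pq s. \<Sum>l\<in>UNIV. (x(s := 0)) k * ?M $ k $ l * (x(s := 0)) l)"
      by (intro sum.mono_neutral_right) (auto simp: pq_def)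
    also have "\<dots> = ?q (pq s) x"
      by (intro sum.cong refl sum.mono_neutral_cong_right) (auto simp: pq_def)
    finally show ?thesis by simp
  qed
  have "psd_on (pq s) ?M \<longleftrightarrow> (\<forall>x. 0 \<le> ?q UNIV (x(s := 0)))"
    unfolding psd_on_def extend using conv_matrix_symmetric by auto
  also have "\<dots> \<longleftrightarrow> (\<forall>x. x s = 0 \<longrightarrow> 0 \<le> ?q UNIV x)"
  proof (intro iffI allI impI)
    fix x :: "'v \<Rightarrow> real"
    assume *: "\<forall>x. 0 \<le> ?q UNIV (x(s := 0))" and "x s = 0"
    from \<open>x s = 0\<close> have "x(s := 0) = x" by (rule fun_upd_idem)
    with spec[OF *, of x] show "0 \<le> ?q UNIV x" by (simp only:)
  next
    fix x :: "'v \<Rightarrow> real"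
    assume *: "\<forall>x. x s = 0 \<longrightarrow> 0 \<le> ?q UNIV x"
    show "0 \<le> ?q UNIV (x(s := 0))"
      by (rule *[THEN spec, THEN mp]) (rule fun_upd_same)
  qed
  also have "\<dots> \<longleftrightarrow> ?rhs"
    by (intro iff_allI imp_cong refl arg_cong[where f = "(\<le>) 0"] quad_form_conv_matrix)
  finally show ?thesis .
qed

text \<open>
  The nonvanishing cosines turn the closed angle bound into an open one, on which the cosine is
  positive.
\<close>
lemma mem_conv_domain_iff:
  "(\<rho>, \<theta>) \<in> conv_domain s E B \<longleftrightarrow>
     \<rho>$s = 0 \<and> \<theta>$s = 0 \<and> (\<forall>(i, j)\<in>E. \<bar>\<theta>$i - \<theta>$j\<bar> < pi / 2) \<and>
     (\<forall>x. x s = 0 \<longrightarrow>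
        0 \<le> (\<Sum>(i, j)\<in>E. B i j * edge_slack (\<rho>$i - \<rho>$j) (\<theta>$i - \<theta>$j) (x i) (x j)))"
proof -
  have "\<bar>t\<bar> \<le> pi / 2 \<and> cos t \<noteq> 0 \<longleftrightarrow> \<bar>t\<bar> < pi / 2" for t :: real
  proof
    assume *: "\<bar>t\<bar> \<le> pi / 2 \<and> cos t \<noteq> 0"
    have "\<bar>t\<bar> \<noteq> pi / 2"
      using * cos_pi_half by (metis cos_abs_real)
    with * show "\<bar>t\<bar> < pi / 2" by simp
  next
    assume *: "\<bar>t\<bar> < pi / 2"
    then have "0 < cos t" by (intro cos_gt_zero_pi) linarith+
    with * show "\<bar>t\<bar> \<le> pi / 2 \<and> cos t \<noteq> 0" by simp
  qed
  then have "(\<forall>(i, j)\<in>E. \<bar>\<theta>$i - \<theta>$j\<bar> \<le> pi / 2) \<and> (\<forall>(i, j)\<in>E. cos (\<theta>$i - \<theta>$j) \<noteq> 0)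
      \<longleftrightarrow> (\<forall>(i, j)\<in>E. \<bar>\<theta>$i - \<theta>$j\<bar> < pi / 2)"
    unfolding ball_conj_distrib[symmetric] split_def by (simp only:)
  then show ?thesis
    unfolding conv_domain_def psd_on_conv_matrix_iff mem_Collect_eq prod.case by (simp only: conj_assoc[symmetric])
qed

lemma convex_conv_domain: "convex (conv_domain s E B)"
proof (rule convexI, clarify)
  fix \<rho> \<theta> \<rho>' \<theta>' :: "real^'v" and \<alpha> \<beta> :: real
  assume p: "(\<rho>, \<theta>) \<in> conv_domain s E B" and p': "(\<rho>', \<theta>') \<in> conv_domain s E B"
    and w: "0 \<le> \<alpha>" "0 \<le> \<beta>" "\<alpha> + \<beta> = 1"
  let ?r = "\<alpha> *\<^sub>R \<rho> + \<beta> *\<^sub>R \<rho>'" and ?t = "\<alpha> *\<^sub>R \<theta> + \<beta> *\<^sub>R \<theta>'"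
  have diff: "?r$i - ?r$j = \<alpha> * (\<rho>$i - \<rho>$j) + \<beta> * (\<rho>'$i - \<rho>'$j)"
     "?t$i - ?t$j = \<alpha> * (\<theta>$i - \<theta>$j) + \<beta> * (\<theta>'$i - \<theta>'$j)" for i j
    by (simp_all add: algebra_simps)
  have ang: "\<bar>\<theta>$i - \<theta>$j\<bar> < pi / 2" "\<bar>\<theta>'$i - \<theta>'$j\<bar> < pi / 2" if "(i, j) \<in> E" for i j
    using p p' that by (auto simp: mem_conv_domain_iff)
  have "(?r, ?t) \<in> conv_domain s E B"
    unfolding mem_conv_domain_iff diff
  proof (intro conjI allI impI)
    show "?r $ s = 0" "?t $ s = 0" using p p' by (auto simp: mem_conv_domain_iff)
    have "\<bar>\<alpha> * a + \<beta> * b\<bar> < pi / 2" if "\<bar>a\<bar> < pi / 2" "\<bar>b\<bar> < pi / 2" for a b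
      using convexD[OF convex_real_interval(8), of a "- (pi / 2)" "pi / 2" b \<alpha> \<beta>] w
        that[THEN abs_less_iff[THEN iffD1]] by (auto simp: abs_if)
    then show "\<forall>(i, j)\<in>E. \<bar>\<alpha> * (\<theta>$i - \<theta>$j) + \<beta> * (\<theta>'$i - \<theta>'$j)\<bar> < pi / 2"
      using ang by blast
  next
    fix x :: "'v \<Rightarrow> real" assume x: "x s = 0"
    let ?S = "\<lambda>u t. \<Sum>(i, j)\<in>E. B i j * edge_slack (u i j) (t i j) (x i) (x j)"
    have "0 \<le> \<alpha> * ?S (\<lambda>i j. \<rho>$i - \<rho>$j) (\<lambda>i j. \<theta>$i - \<theta>$j)
             + \<beta> * ?S (\<lambda>i j. \<rho>'$i - \<rho>'$j) (\<lambda>i j. \<theta>'$i - \<theta>'$j)"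
      using p p' w x by (auto simp: mem_conv_domain_iff)
    also have "\<dots> = (\<Sum>(i, j)\<in>E. B i j *
         (\<alpha> * edge_slack (\<rho>$i - \<rho>$j) (\<theta>$i - \<theta>$j) (x i) (x j)
        + \<beta> * edge_slack (\<rho>'$i - \<rho>'$j) (\<theta>'$i - \<theta>'$j) (x i) (x j)))"
      by (simp add: sum_distrib_left sum.distrib split_def algebra_simps)
    also have "\<dots> \<le> ?S (\<lambda>i j. \<alpha> * (\<rho>$i - \<rho>$j) + \<beta> * (\<rho>'$i - \<rho>'$j))
                       (\<lambda>i j. \<alpha> * (\<theta>$i - \<theta>$j) + \<beta> * (\<theta>'$i - \<theta>'$j))"
    proof (rule sum_mono, clarify)
      fix i j assume e: "(i, j) \<in> E"
      have "0 \<le> B i j" using B_pos[of i j] e by (auto simp: adj_def)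
      then show "B i j * (\<alpha> * edge_slack (\<rho>$i - \<rho>$j) (\<theta>$i - \<theta>$j) (x i) (x j)
        + \<beta> * edge_slack (\<rho>'$i - \<rho>'$j) (\<theta>'$i - \<theta>'$j) (x i) (x j))
        \<le> B i j * edge_slack (\<alpha> * (\<rho>$i - \<rho>$j) + \<beta> * (\<rho>'$i - \<rho>'$j))
            (\<alpha> * (\<theta>$i - \<theta>$j) + \<beta> * (\<theta>'$i - \<theta>'$j)) (x i) (x j)"
        using w ang[OF e] by (intro mult_left_mono edge_slack_concave) auto
    qed
    finally show "0 \<le> ?S (\<lambda>i j. \<alpha> * (\<rho>$i - \<rho>$j) + \<beta> * (\<rho>'$i - \<rho>'$j))
                       (\<lambda>i j. \<alpha> * (\<theta>$i - \<theta>$j) + \<beta> * (\<theta>'$i - \<theta>'$j))" .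
  qed
  then show "\<alpha> *\<^sub>R (\<rho>, \<theta>) + \<beta> *\<^sub>R (\<rho>', \<theta>') \<in> conv_domain s E B"
    by (simp only: scaleR_Pair add_Pair)
qed

end

section \<open>The energy along a segment\<close>

text \<open>
  The right-hand side is the second derivative of one line term in the direction
  \<open>(a, a', b)\<close>, where \<open>b\<close> is the change of the angle difference \<open>t\<close>. With \<open>A = a + a'\<close>, the gap
  between the two sides is \<open>exp (r + r')\<close> times \<open>(A * sin t + b * cos t)\<^sup>2 / cos t\<close>.
\<close>
lemma edge_hessian_ge_edge_slack:
  fixes r r' t a a' b :: real
  assumes "0 < cos t"
  shows "edge_slack (r - r') t (exp r * a) (exp r' * a')
     \<le> 2 * a\<^sup>2 * exp (2 * r) + 2 * a'\<^sup>2 * exp (2 * r')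
       - exp (r + r') * (((a + a')\<^sup>2 - b\<^sup>2) * cos t - 2 * (a + a') * b * sin t)"
proof -
  let ?A = "a + a'"
  have "exp (- (r - r') / 2) * (exp r * a) + exp ((r - r') / 2) * (exp r' * a') = exp ((r + r') / 2) * ?A"
  proof -
    have "- (r - r') / 2 + r = (r + r') / 2" "(r - r') / 2 + r' = (r + r') / 2"
      by (simp_all add: field_simps)
    then show ?thesis
      by (simp only: distrib_left mult.assoc[symmetric] exp_add[symmetric])
  qed
  then have slack: "edge_slack (r - r') t (exp r * a) (exp r' * a')
      = 2 * a\<^sup>2 * exp (2 * r) + 2 * a'\<^sup>2 * exp (2 * r') - exp (r + r') * (?A\<^sup>2 / cos t)"
    by (simp add: edge_slack_def power_mult_distrib flip: exp_double)
  have "0 \<le> (?A * sin t + b * cos t)\<^sup>2 / cos t"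
    using assms by simp
  also have "\<dots> = (?A\<^sup>2 * (sin t)\<^sup>2 + 2 * ?A * b * sin t * cos t + b\<^sup>2 * (cos t)\<^sup>2) / cos t"
    by (simp add: power2_eq_square algebra_simps)
  also have "\<dots> = ?A\<^sup>2 / cos t - ((?A\<^sup>2 - b\<^sup>2) * cos t - 2 * ?A * b * sin t)"
    using assms unfolding sin_squared_eq
    by (simp add: field_simps power2_eq_square)
  finally show ?thesis
    unfolding slack by (intro diff_left_mono mult_left_mono) auto
qed

lemma (in const_ratio_network) energy_convex_on_segment:
  fixes \<rho> \<theta> a b :: "real^'v"
  assumes seg: "\<And>t. t \<in> {0..1} \<Longrightarrow> (\<rho> + t *\<^sub>R a, \<theta> + t *\<^sub>R b) \<in> conv_domain s E B"
  shows "convex_on {0..1} (\<lambda>t. energy s E B \<kappa> P Q (\<rho> + t *\<^sub>R a, \<theta> + t *\<^sub>R b))"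
proof -
  define r where "r t i = \<rho>$i + t * a$i" for t i
  define d where "d t i j = \<theta>$i + t * b$i - (\<theta>$j + t * b$j)" for t i j
  define C where "C i j = B i j * (\<kappa>\<^sup>2 + 1)" for i j
  let ?f' = "\<lambda>t. - (\<Sum>i\<in>pq s. (P i + \<kappa> * Q i) * b$i + (\<kappa> * P i - Q i) * a$i)
     + (\<Sum>(i, j)\<in>E. C i j * (a$i * exp (2 * r t i) + a$j * exp (2 * r t j)))
     - (\<Sum>(i, j)\<in>E. C i j * (exp (r t i + r t j) *
          ((a$i + a$j) * cos (d t i j) - (b$i - b$j) * sin (d t i j))))"
  let ?f'' = "\<lambda>t. (\<Sum>(i, j)\<in>E. C i j * (2 * (a$i)\<^sup>2 * exp (2 * r t i) + 2 * (a$j)\<^sup>2 * exp (2 * r t j)))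
     - (\<Sum>(i, j)\<in>E. C i j * (exp (r t i + r t j) *
          (((a$i + a$j)\<^sup>2 - (b$i - b$j)\<^sup>2) * cos (d t i j) - 2 * (a$i + a$j) * (b$i - b$j) * sin (d t i j))))"
  show ?thesis
  proof (rule f''_ge0_imp_convex[where f' = ?f' and f'' = ?f''])
    fix t :: real
    show "((\<lambda>t. energy s E B \<kappa> P Q (\<rho> + t *\<^sub>R a, \<theta> + t *\<^sub>R b)) has_real_derivative ?f' t) (at t)"
      unfolding energy_def split_def r_def d_def C_def
      by (auto intro!: derivative_eq_intros sum.cong simp: algebra_simps)
    show "(?f' has_real_derivative ?f'' t) (at t)"
      unfolding split_def r_def d_def
      by (auto intro!: derivative_eq_intros sum.cong simp: algebra_simps power2_eq_square)
  next
    fix t :: real assume t: "t \<in> {0..1}"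
    \<comment> \<open>rescaling by \<open>exp \<rho>\<close> turns the Hessian bound into the quadratic form of the domain\<close>
    define x where "x i = exp (r t i) * a$i" for i
    have dom: "(\<rho> + t *\<^sub>R a) $ s = 0" "\<And>i j. (i, j) \<in> E \<Longrightarrow> \<bar>d t i j\<bar> < pi / 2"
      "\<And>y. y s = 0 \<Longrightarrow> 0 \<le> (\<Sum>(i, j)\<in>E. B i j * edge_slack (r t i - r t j) (d t i j) (y i) (y j))"
      using seg[OF t] by (auto simp: mem_conv_domain_iff r_def d_def)
    \<comment> \<open>both end points have slack coordinate \<open>0\<close>, hence so has the direction\<close>
    have "\<rho>$s = 0" "(\<rho> + 1 *\<^sub>R a) $ s = 0"
      using seg[of 0] seg[of 1] by (auto simp: mem_conv_domain_iff)
    then have "x s = 0" by (simp add: x_def)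
    then have "0 \<le> (\<Sum>(i, j)\<in>E. B i j * edge_slack (r t i - r t j) (d t i j) (x i) (x j))"
      by (rule dom(3))
    then have "0 \<le> (\<kappa>\<^sup>2 + 1) * (\<Sum>(i, j)\<in>E. B i j * edge_slack (r t i - r t j) (d t i j) (x i) (x j))"
      by simp
    also have "\<dots> = (\<Sum>(i, j)\<in>E. C i j * edge_slack (r t i - r t j) (d t i j) (x i) (x j))"
      by (simp add: sum_distrib_left split_def C_def algebra_simps)
    also have "\<dots> \<le> (\<Sum>(i, j)\<in>E. C i j *
        (2 * (a$i)\<^sup>2 * exp (2 * r t i) + 2 * (a$j)\<^sup>2 * exp (2 * r t j)
         - exp (r t i + r t j) * (((a$i + a$j)\<^sup>2 - (b$i - b$j)\<^sup>2) * cos (d t i j)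
             - 2 * (a$i + a$j) * (b$i - b$j) * sin (d t i j))))"
    proof (rule sum_mono, clarify)
      fix i j assume e: "(i, j) \<in> E"
      have "0 \<le> C i j" using B_pos[of i j] e by (auto simp: adj_def C_def)
      moreover have "0 < cos (d t i j)"
        using dom(2)[OF e] by (auto intro!: cos_gt_zero_pi)
      ultimately show "C i j * edge_slack (r t i - r t j) (d t i j) (x i) (x j) \<le> C i j *
        (2 * (a$i)\<^sup>2 * exp (2 * r t i) + 2 * (a$j)\<^sup>2 * exp (2 * r t j)
         - exp (r t i + r t j) * (((a$i + a$j)\<^sup>2 - (b$i - b$j)\<^sup>2) * cos (d t i j)
             - 2 * (a$i + a$j) * (b$i - b$j) * sin (d t i j)))"
        unfolding x_def by (intro mult_left_mono edge_hessian_ge_edge_slack)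
    qed
    also have "\<dots> = ?f'' t"
      by (simp add: right_diff_distrib sum_subtractf split_def)
    finally show "0 \<le> ?f'' t" .
  qed simp
qed

theorem mainTheorem3:
  fixes s :: "'v::finite"
    and E :: "('v \<times> 'v) set"
    and G B :: "'v \<Rightarrow> 'v \<Rightarrow> real"
    and \<kappa> :: real
    and P Q :: "'v \<Rightarrow> real"
  assumes "const_ratio_network E G B \<kappa>"
  shows "convex_on (conv_domain s E B) (energy s E B \<kappa> P Q)"
proof -
  interpret const_ratio_network E G B \<kappa> by (fact assms)
  show ?thesis
  proof (rule convex_onI[OF _ convex_conv_domain])
    fix t :: real and p p' :: "(real^'v) \<times> (real^'v)"
    assume t: "0 < t" "t < 1" and mem: "p \<in> conv_domain s E B" "p' \<in> conv_domain s E B"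
    obtain \<rho> \<theta> \<rho>' \<theta>' where p: "p = (\<rho>, \<theta>)" "p' = (\<rho>', \<theta>')"
      by (cases p; cases p')
    have line: "(\<rho> + u *\<^sub>R (\<rho>' - \<rho>), \<theta> + u *\<^sub>R (\<theta>' - \<theta>)) = (1 - u) *\<^sub>R p + u *\<^sub>R p'" for u
      by (simp add: p algebra_simps)
    have "(1 - u) *\<^sub>R p + u *\<^sub>R p' \<in> conv_domain s E B" if "u \<in> {0..1}" for u
      using convexD[OF convex_conv_domain mem, of "1 - u" u] that by auto
    then have "convex_on {0..1} (\<lambda>u. energy s E B \<kappa> P Q ((1 - u) *\<^sub>R p + u *\<^sub>R p'))"
      using energy_convex_on_segment[of \<rho> "\<rho>' - \<rho>" \<theta> "\<theta>' - \<theta>" s P Q] by (simp only: line)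
    from convex_onD[OF this, of t 0 1] t
    show "energy s E B \<kappa> P Q ((1 - t) *\<^sub>R p + t *\<^sub>R p')
        \<le> (1 - t) * energy s E B \<kappa> P Q p + t * energy s E B \<kappa> P Q p'"
      by simp
  qed
qed

end
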